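(* Let $s\ge1$ and let $y\in X$ with $\mu(\{y\})=0$ and $\overline{d}_\mu(y)<\infty$. Suppose that $$\liminf_{r\to0}\frac{\log\tau_{B(y,r)}(x)}{-\log\mu(B(y,r))}\le s\qquad\text{for } \mu\text{-a.e. } x\in X.$$ Then every nonincreasing sequence $(r_n)_{n\in\mathbb{N}}$ of (positive) radii with $$\limsup_{n\to\infty}\frac{-\log r_n}{\log n}<\frac{1}{s\,\overline{d}_\mu(y)}\qquad( * )$$ satisfies $\mu\bigl(\limsup_nT^{-n}B(y,r_n)\bigr)=1$, i.e. $\{B(y,r_n)\}$ is a BC sequence for $T$. Moreover, if the local dimension $d_\mu(y)$ exists in $(0,\infty)$, every nonincreasing sequence $(r_n)$ satisfying $( * )$ also satisfies $\sum_n\mu(B(y,r_n))^s=\infty$.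
   Context: Standing assumptions: $(X,d)$ is a metric space, $\mu$ is a Borel probability measure on $X$, and $T:X\to X$ is measurable and preserves $\mu$, i.e. $\mu(T^{-1}A)=\mu(A)$ for all Borel $A$. $\mathbb{N}=\{1,2,\dots\}$. $B(y,r)=\{x\in X: d(x,y)\le r\}$ is the closed ball of center $y$ and radius $r>0$. BC sequence: a sequence $\{A_n\}_{n\in\mathbb{N}}$ of measurable subsets of $X$ is a Borel-Cantelli (BC) sequence for $T$ if $\mu(\limsup_n T^{-n}A_n)=1$, where $\limsup_n T^{-n}A_n=\{x: T^nx\in A_n\text{ for infinitely many }n\}$. Waiting time: for measurable $A\subset X$, $\tau_A(x)=\min\{n\in\mathbb{N}:T^nx\in A\}\in\mathbb{N}\cup\{\infty\}$ (with $\log\infty=\infty$). Local dimensions: $\underline{d}_\mu(y)=\liminf_{r\to0}\frac{\log\mu(B(y,r))}{\log r}$ and $\overline{d}_\mu(y)=\limsup_{r\to0}\frac{\log\mu(B(y,r))}{\log r}$ (with $\log 0=-\infty$, so that $\overline{d}_\mu(y)<\infty$ forces $\mu(B(y,r))>0$ for all $r>0$); $d_\mu(y)$ denotes their common value when they coincide. Convention: $1/(s\cdot0)=\infty$. *)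

theory Defs
  imports "HOL-Probability.Probability"
begin

text \<open>Sequences indexed by \<open>{1, 2, \<dots>}\<close> are functions on \<^typ>\<open>nat\<close> whose value at \<open>0\<close> is
  never constrained and never used.\<close>

definition eln :: "ereal \<Rightarrow> ereal" where
  "eln x = (if x \<le> 0 then -\<infinity> else if x = \<infinity> then \<infinity> else ereal (ln (real_of_ereal x)))"

text \<open>The term \<open>n = 0\<close> has no effect on the limit superior, so this is the set of \<open>x\<close> with
  \<open>(T ^^ n) x \<in> A n\<close> for infinitely many \<open>n \<ge> 1\<close>.\<close>

definition borel_cantelli_seq :: "'a measure \<Rightarrow> ('a \<Rightarrow> 'a) \<Rightarrow> (nat \<Rightarrow> 'a set) \<Rightarrow> bool" where
  "borel_cantelli_seq M T A \<longleftrightarrow>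
     (\<forall>n\<ge>1. A n \<in> sets M) \<and>
     measure M (limsup (\<lambda>n. (T ^^ n) -` A n \<inter> space M)) = 1"

text \<open>On \<^typ>\<open>enat\<close> the infimum of the empty set is \<open>\<infinity>\<close>, and otherwise it is the minimum.\<close>

definition waiting_time :: "('a \<Rightarrow> 'a) \<Rightarrow> 'a set \<Rightarrow> 'a \<Rightarrow> enat" where
  "waiting_time T A x = Inf {enat n | n. n \<ge> 1 \<and> (T ^^ n) x \<in> A}"

definition lower_local_dim :: "'a::metric_space measure \<Rightarrow> 'a \<Rightarrow> ereal" where
  "lower_local_dim M y =
     Liminf (at_right 0) (\<lambda>r. eln (ereal (measure M (cball y r))) / ereal (ln r))"

definition upper_local_dim :: "'a::metric_space measure \<Rightarrow> 'a \<Rightarrow> ereal" where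
  "upper_local_dim M y =
     Limsup (at_right 0) (\<lambda>r. eln (ereal (measure M (cball y r))) / ereal (ln r))"

text \<open>Division on \<^typ>\<open>ereal\<close> satisfies \<open>1 / 0 = \<infinity>\<close>, so the bound below is \<open>\<infinity>\<close>
  when the upper local dimension vanishes.\<close>

definition slow_radii :: "'a::metric_space measure \<Rightarrow> 'a \<Rightarrow> real \<Rightarrow> (nat \<Rightarrow> real) \<Rightarrow> bool" where
  "slow_radii M y s r \<longleftrightarrow>
     (\<forall>n\<ge>1. 0 < r n) \<and> antimono_on {1..} r \<and>
     limsup (\<lambda>n. ereal (- ln (r n) / ln (real n))) < 1 / (ereal s * upper_local_dim M y)"

end

theory Submission
  imports Defs
begin

text \<open>Choose \<open>\<alpha>, D > 0\<close> and \<open>s' > s\<close> such that \<open>r\<^sub>n \<ge> n\<^sup>-\<^sup>\<alpha>\<close> eventually, \<open>\<mu>(B(y,r)) > r\<^sup>D\<close> for small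
  \<open>r\<close>, and \<open>s' \<alpha> D < 1\<close>. For almost every \<open>x\<close> there are arbitrarily small \<open>r\<close> whose waiting time
  \<open>n = \<tau>\<^bsub>B(y,r)\<^esub>(x)\<close> satisfies \<open>n \<le> \<mu>(B(y,r))\<^sup>-\<^sup>s\<^sup>' \<le> r\<^sup>-\<^sup>s\<^sup>'\<^sup>D\<close>, whence \<open>r \<le> n\<^sup>-\<^sup>\<alpha>\<close> and \<open>T\<^sup>n x \<in> B(y,n\<^sup>-\<^sup>\<alpha>)\<close>.
  If only finitely many \<open>n\<close> arose in this way, one of them would serve arbitrarily small \<open>r\<close>, so
  that \<open>T\<^sup>n x = y\<close>; this happens only on a null set. The divergence of the series follows from
  \<open>\<mu>(B(y,r\<^sub>n))\<^sup>s \<ge> n\<^sup>-\<^sup>s\<^sup>\<alpha>\<^sup>D\<close>.\<close>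

section \<open>Waiting times and logarithmic ratios\<close>

text \<open>A finite infimum in \<open>enat\<close> comes from a nonempty set and is attained there,
  by well-ordering.\<close>

lemma waiting_time_eq_enatD:
  assumes "waiting_time T A x = enat n"
  shows "n \<ge> 1" "(T ^^ n) x \<in> A"
proof -
  let ?S = "{enat n | n. n \<ge> 1 \<and> (T ^^ n) x \<in> A}"
  have "?S \<noteq> {}"
  proof
    assume "?S = {}"
    then have "Inf ?S = \<infinity>"
      by (simp add: Inf_enat_def)
    with assms show False
      by (simp add: waiting_time_def)
  qed
  then have "Inf ?S \<in> ?S"
    by (metis (no_types, lifting) Inf_enat_def LeastI ex_in_conv)
  then show "n \<ge> 1" "(T ^^ n) x \<in> A"
    using assms by (auto simp: waiting_time_def)
qed

lemma eln_ereal_pos: "0 < a \<Longrightarrow> eln (ereal a) = ereal (ln a)"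
  by (simp add: eln_def)

text \<open>A finite bound on the ratio excludes \<open>m = 0\<close>, where the ratio is
  \<open>-\<infinity>\<close> over a negative number, that is \<open>\<infinity>\<close>. For
  \<open>m > 0\<close>, clearing the negative denominator \<open>ln r\<close> reverses the
  inequality.\<close>

lemma powr_less_if_eln_ratio_less:
  assumes "0 < r" "r < 1" "0 \<le> m" "eln (ereal m) / ereal (ln r) < ereal D"
  shows "r powr D < m"
proof -
  have lr: "ln r < 0"
    using assms by simp
  have "m \<noteq> 0"
  proof
    assume "m = 0"
    then have "eln (ereal m) / ereal (ln r) = \<infinity>"
      using lr by (simp add: eln_def divide_ereal_def)
    with assms show False by simp
  qed
  then have m: "m > 0"
    using assms by simp
  then have "ln m / ln r < D"
    using assms lr by (simp add: eln_ereal_pos)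
  then have "D * ln r < ln m"
    using lr by (simp add: neg_divide_less_eq)
  then show ?thesis
    using m assms by (metis ln_less_cancel_iff ln_powr powr_gt_zero less_irrefl)
qed

text \<open>Since \<open>0 < m < 1\<close>, the denominator is positive and finite. An infinite
  waiting time would thus make the ratio \<open>\<infinity>\<close>, so the bound yields an actual
  visit to \<open>A\<close>.\<close>

lemma waiting_time_if_eln_ratio_less:
  assumes "0 < m" "m < 1"
    and "eln (ereal_of_enat (waiting_time T A x)) / (- eln (ereal m)) < ereal s"
  obtains n where "n \<ge> 1" "(T ^^ n) x \<in> A" "ln (real n) < s * (- ln m)"
proof (cases "waiting_time T A x")
  case (enat n)
  note n = waiting_time_eq_enatD[OF this]
  have "ln (real n) / (- ln m) < s"
    using assms n(1) enat by (simp add: eln_ereal_pos)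
  then have "ln (real n) < s * (- ln m)"
    using assms by (subst (asm) pos_divide_less_eq) auto
  with n that show ?thesis
    by blast
next
  case infinity
  then have "eln (ereal_of_enat (waiting_time T A x)) / (- eln (ereal m)) = \<infinity>"
    using assms by (simp add: eln_ereal_pos eln_def divide_ereal_def)
  with assms show ?thesis by simp
qed

section \<open>Measure of small balls around \<open>y\<close>\<close>

text \<open>Continuity from above along the balls of radius \<open>1/(n+1)\<close>, which shrink to
  the null set \<open>{y}\<close>. The strict bound keeps the denominator of the waiting time ratio
  positive.\<close>

lemma eventually_measure_cball_less_1:
  fixes M :: "'a::metric_space measure"
  assumes "prob_space M" and sets: "sets M = sets borel" and "measure M {y} = 0"
  shows "eventually (\<lambda>r. measure M (cball y r) < 1) (at_right 0)"
proof -
  interpret prob_space M by fact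
  let ?A = "\<lambda>n. cball y (inverse (real (Suc n)))"
  have "(\<Inter>n. ?A n) = {y}"
  proof (intro equalityI subsetI)
    fix x assume x: "x \<in> (\<Inter>n. ?A n)"
    show "x \<in> {y}"
    proof (rule ccontr)
      assume "x \<notin> {y}"
      then have "0 < dist y x"
        by simp
      then obtain n where "inverse (real (Suc n)) < dist y x"
        using reals_Archimedean by blast
      moreover have "x \<in> ?A n"
        using x by blast
      ultimately show False
        by (auto simp: mem_cball)
    qed
  qed simp
  moreover have "(\<lambda>n. measure M (?A n)) \<longlonglongrightarrow> measure M (\<Inter>n. ?A n)"
    by (intro finite_Lim_measure_decseq)
       (auto simp: sets intro!: decseq_SucI subset_cball le_imp_inverse_le)
  ultimately have "(\<lambda>n. measure M (?A n)) \<longlonglongrightarrow> 0"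
    using assms by simp
  then have "eventually (\<lambda>n. measure M (?A n) < 1) sequentially"
    by (rule order_tendstoD) simp
  then obtain n where n: "measure M (?A n) < 1"
    by (auto simp: eventually_sequentially)
  have "measure M (cball y r) < 1" if "r < inverse (real (Suc n))" for r
  proof -
    have "measure M (cball y r) \<le> measure M (?A n)"
      using that by (intro finite_measure_mono subset_cball) (auto simp: sets)
    with n show ?thesis by simp
  qed
  then show ?thesis
    by (auto simp: eventually_at_right_field intro!: exI[of _ "inverse (real (Suc n))"])
qed

lemma eventually_powr_less_measure_cball:
  fixes M :: "'a::metric_space measure"
  assumes "prob_space M" and "upper_local_dim M y < ereal D"
  shows "eventually (\<lambda>r. r powr D < measure M (cball y r)) (at_right 0)"
proof -
  interpret prob_space M by fact
  have "eventually (\<lambda>r. eln (ereal (measure M (cball y r))) / ereal (ln r) < ereal D) (at_right 0)"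
    using assms(2) unfolding upper_local_dim_def by (rule Limsup_lessD)
  moreover have "eventually (\<lambda>r::real. r < 1) (at_right 0)" "eventually (\<lambda>r::real. 0 < r) (at_right 0)"
    by (auto simp: eventually_at_right_field intro!: exI[of _ 1])
  ultimately show ?thesis
    by eventually_elim (auto intro: powr_less_if_eln_ratio_less)
qed

text \<open>For \<open>r < 1\<close> both logarithms are nonpositive, so the ratio is
  nonnegative.\<close>

lemma upper_local_dim_nonneg:
  fixes M :: "'a::metric_space measure"
  assumes "prob_space M"
  shows "0 \<le> upper_local_dim M y"
proof -
  interpret prob_space M by fact
  show ?thesis
    unfolding upper_local_dim_def
  proof (rule le_Limsup)
    have "eventually (\<lambda>r::real. r < 1) (at_right 0)" "eventually (\<lambda>r::real. 0 < r) (at_right 0)"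
      by (auto simp: eventually_at_right_field intro!: exI[of _ 1])
    then show "eventually (\<lambda>r. 0 \<le> eln (ereal (measure M (cball y r))) / ereal (ln r)) (at_right 0)"
    proof eventually_elim
      case (elim r)
      show ?case
      proof (cases "measure M (cball y r) = 0")
        case True
        then show ?thesis
          using elim by (simp add: eln_def divide_ereal_def)
      next
        case False
        then have "0 < measure M (cball y r)"
          by (simp add: zero_less_measure_iff)
        then show ?thesis
          using elim by (simp add: eln_ereal_pos divide_nonpos_neg)
      qed
    qed
  qed simp
qed

section \<open>Choice of the exponents\<close>

lemma slow_radii_exponents:
  fixes M :: "'a::metric_space measure"
  assumes "prob_space M" and "slow_radii M y s r" "s \<ge> 1" "upper_local_dim M y < \<infinity>"
  obtains \<alpha> D s' where "0 < \<alpha>" "0 < D" "s < s'" "upper_local_dim M y < ereal D" "s' * D * \<alpha> < 1"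
    "eventually (\<lambda>n. real n powr - \<alpha> \<le> r n) sequentially"
proof -
  interpret prob_space M by fact
  let ?L = "limsup (\<lambda>n. ereal (- ln (r n) / ln (real n)))"
  obtain d where d: "upper_local_dim M y = ereal d" "0 \<le> d"
    using upper_local_dim_nonneg[OF assms(1), of y] assms(4) by (cases "upper_local_dim M y") auto
  \<comment> \<open>For \<open>d = 0\<close> the right-hand side is \<open>\<infinity>\<close>, and
    every positive \<open>\<alpha>\<close> is admissible below.\<close>
  have "0 < 1 / (ereal s * upper_local_dim M y)"
    using assms(3) d by (cases "d = 0") (simp_all add: one_ereal_def)
  \<comment> \<open>The limsup may be negative; the maximum with \<open>0\<close> ensures
    \<open>\<alpha> > 0\<close>.\<close>
  then have "max 0 ?L < 1 / (ereal s * upper_local_dim M y)"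
    using assms(2) by (simp add: slow_radii_def)
  then obtain \<alpha> where \<alpha>: "max 0 ?L < ereal \<alpha>" "ereal \<alpha> < 1 / (ereal s * upper_local_dim M y)"
    using ereal_dense2 by blast
  have \<alpha>_pos: "0 < \<alpha>"
    using \<alpha>(1) by simp
  have "s * d * \<alpha> < 1"
  proof (cases "d = 0")
    case False
    then have "\<alpha> < 1 / (s * d)"
      using \<alpha>(2) d assms by (simp add: one_ereal_def)
    then show ?thesis
      using False d assms by (simp add: pos_less_divide_eq mult.commute)
  qed simp
  \<comment> \<open>By continuity \<open>s\<close> and \<open>d\<close> can both be raised by a
    small \<open>h > 0\<close> without losing the strict inequality. This leaves room for
    \<open>s' = s + h\<close> and \<open>D = d + h\<close>.\<close>
  moreover have "((\<lambda>h. (s + h) * (d + h) * \<alpha>) \<longlongrightarrow> (s + 0) * (d + 0) * \<alpha>) (at_right 0)"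
    by (intro tendsto_intros)
  ultimately have "eventually (\<lambda>h. (s + h) * (d + h) * \<alpha> < 1) (at_right 0)"
    by (auto dest: order_tendstoD)
  moreover have "eventually (\<lambda>h::real. 0 < h) (at_right 0)"
    by (rule eventually_at_right_less)
  ultimately have "eventually (\<lambda>h. 0 < h \<and> (s + h) * (d + h) * \<alpha> < 1) (at_right 0)"
    by eventually_elim simp
  then obtain h where h: "0 < h" "(s + h) * (d + h) * \<alpha> < 1"
    using eventually_happens'[of "at_right (0::real)"] by auto
  have "?L < ereal \<alpha>"
    using \<alpha>(1) by simp
  then have "eventually (\<lambda>n. ereal (- ln (r n) / ln (real n)) < ereal \<alpha>) sequentially"
    by (rule Limsup_lessD)
  then have "eventually (\<lambda>n. real n powr - \<alpha> \<le> r n) sequentially"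
    using eventually_ge_at_top[of 2]
  proof eventually_elim
    case (elim n)
    then have pos: "0 < ln (real n)" "0 < r n"
      using assms(2) by (auto simp: slow_radii_def)
    then have "- ln (r n) < \<alpha> * ln (real n)"
      using elim(1) by (simp only: less_ereal.simps pos_divide_less_eq)
    then have "- \<alpha> * ln (real n) < ln (r n)"
      by simp
    then have "ln (real n powr - \<alpha>) \<le> ln (r n)"
      using elim by (simp add: ln_powr)
    then show ?case
      using pos elim by (subst (asm) ln_le_cancel_iff) auto
  qed
  then show ?thesis
    using that[of \<alpha> "d + h" "s + h"] \<alpha>_pos h d by simp
qed

section \<open>Recurrence to the shrinking balls\<close>

lemma frequently_visits_cball_powr:
  fixes y :: "'a::metric_space"
  assumes exps: "0 < \<alpha>" "0 < s" "0 < D" "s * D * \<alpha> \<le> 1"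
    and lower: "eventually (\<lambda>r. r powr D < measure M (cball y r)) (at_right 0)"
    and less_1: "eventually (\<lambda>r. measure M (cball y r) < 1) (at_right 0)"
    and wait: "Liminf (at_right 0) (\<lambda>r. eln (ereal_of_enat (waiting_time T (cball y r) x))
                 / (- eln (ereal (measure M (cball y r))))) < ereal s"
    and avoid: "\<And>n. n \<ge> 1 \<Longrightarrow> (T ^^ n) x \<noteq> y"
  shows "frequently (\<lambda>n. (T ^^ n) x \<in> cball y (real n powr - \<alpha>)) sequentially"
proof -
  let ?ratio = "\<lambda>r. eln (ereal_of_enat (waiting_time T (cball y r) x))
                 / (- eln (ereal (measure M (cball y r))))"
  have freq: "frequently (\<lambda>r. ?ratio r < ereal s) (at_right 0)"
  proof (rule ccontr)
    assume "\<not> ?thesis"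
    then have "eventually (\<lambda>r. ereal s \<le> ?ratio r) (at_right 0)"
      by (simp add: not_frequently not_less)
    then have "ereal s \<le> Liminf (at_right 0) ?ratio"
      by (rule Liminf_bounded)
    with wait show False by simp
  qed
  have "\<exists>n\<ge>N. (T ^^ n) x \<in> cball y (real n powr - \<alpha>)" for N
  proof -
    \<comment> \<open>The orbit avoids \<open>y\<close>, so small balls miss its first
      \<open>N - 1\<close> points. A visit to such a ball at a time \<open>n \<ge> 1\<close>
      therefore has \<open>n \<ge> N\<close>.\<close>
    have "eventually (\<lambda>r. \<forall>n\<in>{1..<N}. r < dist y ((T ^^ n) x)) (at_right 0)"
    proof (intro eventually_ball_finite ballI)
      fix n assume "n \<in> {1..<N}"
      then have "0 < dist y ((T ^^ n) x)"
        using avoid[of n] by auto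
      then show "eventually (\<lambda>r. r < dist y ((T ^^ n) x)) (at_right 0)"
        unfolding eventually_at_right_field by blast
    qed simp
    with lower less_1 eventually_at_right_less[of "0::real"]
    have "eventually (\<lambda>r. ?ratio r < ereal s \<longrightarrow> ?ratio r < ereal s \<and>
        (\<forall>n\<in>{1..<N}. r < dist y ((T ^^ n) x)) \<and>
        0 < r \<and> r powr D < measure M (cball y r) \<and> measure M (cball y r) < 1) (at_right 0)"
      by eventually_elim blast
    with freq have "frequently (\<lambda>r. ?ratio r < ereal s \<and> (\<forall>n\<in>{1..<N}. r < dist y ((T ^^ n) x)) \<and>
        0 < r \<and> r powr D < measure M (cball y r) \<and> measure M (cball y r) < 1) (at_right 0)"
      by (rule frequently_rev_mp)
    then obtain r where r: "?ratio r < ereal s" "\<forall>n\<in>{1..<N}. r < dist y ((T ^^ n) x)" "0 < r"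
        "r powr D < measure M (cball y r)" "measure M (cball y r) < 1"
      by (auto dest: frequently_ex)
    have m: "0 < measure M (cball y r)"
      using r(4) by (rule le_less_trans[OF powr_ge_zero])
    obtain n where n: "n \<ge> 1" "(T ^^ n) x \<in> cball y r" "ln (real n) < s * (- ln (measure M (cball y r)))"
      using waiting_time_if_eln_ratio_less[OF m r(5,1)] by metis
    have "n \<ge> N"
      using r(2) n(1,2) by (force simp: mem_cball)
    have "D * ln r < ln (measure M (cball y r))"
      using r(3,4) m by (metis ln_less_cancel_iff ln_powr powr_gt_zero less_irrefl)
    then have "s * (- ln (measure M (cball y r))) \<le> s * (D * (- ln r))"
      using exps by (intro mult_left_mono) auto
    with n(3) have le: "ln (real n) \<le> s * D * (- ln r)"
      by (simp add: mult.assoc)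
    \<comment> \<open>This forces \<open>r \<le> 1\<close>, the sign needed to replace the factor
      \<open>s * D * \<alpha>\<close> by \<open>1\<close> below.\<close>
    moreover have "0 \<le> ln (real n)"
      using n(1) by simp
    ultimately have "0 \<le> - ln r"
      using exps by (metis mult_pos_pos order_trans zero_le_mult_iff not_le)
    have "\<alpha> * ln (real n) \<le> \<alpha> * (s * D * (- ln r))"
      using le exps by (intro mult_left_mono) auto
    also have "\<dots> = (s * D * \<alpha>) * (- ln r)"
      by simp
    also have "\<dots> \<le> 1 * (- ln r)"
      using exps \<open>0 \<le> - ln r\<close> by (intro mult_right_mono)
    finally have "ln r \<le> ln (real n powr - \<alpha>)"
      using n(1) by (simp add: ln_powr)
    then have "r \<le> real n powr - \<alpha>"
      using r(3) n(1) by (subst (asm) ln_le_cancel_iff) auto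
    with n(2) have "(T ^^ n) x \<in> cball y (real n powr - \<alpha>)"
      by (auto simp: mem_cball)
    with \<open>n \<ge> N\<close> show ?thesis
      by blast
  qed
  then show ?thesis
    by (simp add: frequently_sequentially)
qed

section \<open>Invariance under iterates and divergence of the series\<close>

lemma measure_vimage_funpow:
  assumes T: "T \<in> measurable M M" and "space M = UNIV"
    and inv: "\<And>A. A \<in> sets M \<Longrightarrow> measure M (T -` A) = measure M A"
    and "A \<in> sets M"
  shows "measure M ((T ^^ n) -` A) = measure M A"
proof (induction n)
  case (Suc n)
  have "T ^^ n \<in> measurable M M"
    using T by (induction n) (auto intro: measurable_comp)
  then have "(T ^^ n) -` A \<in> sets M"
    using measurable_sets[of "T ^^ n" M M A] assms by simp
  moreover have "(T ^^ Suc n) -` A = T -` ((T ^^ n) -` A)"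
    by (simp add: vimage_comp funpow_Suc_right del: funpow.simps)
  ultimately show ?case
    using Suc inv by (simp del: funpow.simps)
qed simp

lemma suminf_ennreal_powr_eq_top:
  assumes "eventually (\<lambda>n. real n powr - t \<le> f n) sequentially" "t \<le> 1"
  shows "(\<Sum>n. ennreal (f (Suc n))) = \<infinity>"
proof (rule ccontr)
  assume fin: "(\<Sum>n. ennreal (f (Suc n))) \<noteq> \<infinity>"
  \<comment> \<open>\<open>ennreal\<close> sends negative reals to \<open>0\<close>, so truncating
    \<open>f\<close> keeps the sum and allows passing to real summability of nonnegative
    terms.\<close>
  have "(\<Sum>n. ennreal (max 0 (f (Suc n)))) = (\<Sum>n. ennreal (f (Suc n)))"
    by (intro suminf_cong) (auto simp: max_def ennreal_neg)
  then have "summable (\<lambda>n. max 0 (f (Suc n)))"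
    using fin by (intro summable_suminf_not_top) auto
  then have "summable (\<lambda>n. max 0 (f n))"
    by (rule summable_Suc_iff[THEN iffD1])
  then have "summable (\<lambda>n. real n powr - t)"
  proof (rule summable_comparison_test_ev[rotated])
    show "eventually (\<lambda>n. norm (real n powr - t) \<le> max 0 (f n)) sequentially"
      using assms(1) by eventually_elim auto
  qed
  with assms(2) show False
    by (simp add: summable_real_powr_iff)
qed

theorem corollary6p3:
  fixes M :: "'a::metric_space measure" and T :: "'a \<Rightarrow> 'a" and y :: 'a and s :: real
  assumes "prob_space M" and "sets M = sets borel"
    and "T \<in> measurable M M"
    and "\<And>A. A \<in> sets borel \<Longrightarrow> measure M (T -` A) = measure M A"
    and "s \<ge> 1"
    and "measure M {y} = 0"
    and "upper_local_dim M y < \<infinity>"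
    and "AE x in M. Liminf (at_right 0)
           (\<lambda>r. eln (ereal_of_enat (waiting_time T (cball y r) x))
                 / (- eln (ereal (measure M (cball y r))))) \<le> ereal s"
  shows "(\<forall>r. slow_radii M y s r \<longrightarrow> borel_cantelli_seq M T (\<lambda>n. cball y (r n))) \<and>
         (lower_local_dim M y = upper_local_dim M y \<and> upper_local_dim M y \<in> {0<..<\<infinity>} \<longrightarrow>
           (\<forall>r. slow_radii M y s r \<longrightarrow>
             (\<Sum>n. ennreal (measure M (cball y (r (Suc n))) powr s)) = \<infinity>))"
proof -
  interpret prob_space M by fact
  have space: "space M = UNIV"
    using sets_eq_imp_space_eq[OF assms(2)] by simp
  have T_pow: "T ^^ n \<in> measurable M M" for n
    using assms(3) by (induction n) (auto intro: measurable_comp)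
  \<comment> \<open>By invariance every preimage of the null set \<open>{y}\<close> is null;
    countably many of them are discarded together.\<close>
  have "AE x in M. (T ^^ n) x \<noteq> y" for n
  proof (rule AE_I)
    show "{x \<in> space M. \<not> (T ^^ n) x \<noteq> y} \<subseteq> (T ^^ n) -` {y}"
      by auto
    have "measure M ((T ^^ n) -` {y}) = 0"
      using measure_vimage_funpow[OF assms(3) space, of "{y}" n] assms by simp
    then show "emeasure M ((T ^^ n) -` {y}) = 0"
      by (simp add: emeasure_eq_measure)
    show "(T ^^ n) -` {y} \<in> sets M"
      using measurable_sets[OF T_pow, of "{y}" n] assms(2) space by simp
  qed
  then have avoid: "AE x in M. \<forall>n. (T ^^ n) x \<noteq> y"
    by (simp add: AE_all_countable)
  have "borel_cantelli_seq M T (\<lambda>n. cball y (r n)) \<and>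
      (\<Sum>n. ennreal (measure M (cball y (r (Suc n))) powr s)) = \<infinity>" if slow: "slow_radii M y s r" for r
  proof -
    obtain \<alpha> D s' where exps: "0 < \<alpha>" "0 < D" "s < s'" "s' * D * \<alpha> < 1"
      and D: "upper_local_dim M y < ereal D"
      and ev: "eventually (\<lambda>n. real n powr - \<alpha> \<le> r n) sequentially"
      using slow_radii_exponents[OF assms(1) slow assms(5,7)] by metis
    note lower = eventually_powr_less_measure_cball[OF assms(1) D]
    let ?A = "\<lambda>n. (T ^^ n) -` cball y (r n) \<inter> space M"
    have A_sets: "?A n \<in> sets M" for n
      by (rule measurable_sets[OF T_pow]) (simp add: assms(2))
    have "AE x in M. x \<in> limsup ?A"
      using assms(8) avoid
    proof eventually_elim
      case (elim x)
      \<comment> \<open>Passing from \<open>s\<close> to \<open>s' > s\<close> turns the bound on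
        the liminf into the strict one that yields arbitrarily small good radii.\<close>
      have "frequently (\<lambda>n. (T ^^ n) x \<in> cball y (real n powr - \<alpha>)) sequentially"
        using exps assms(5) elim
        by (intro frequently_visits_cball_powr[where s = s' and D = D and M = M and T = T] lower
              eventually_measure_cball_less_1 assms) (auto elim: le_less_trans)
      then have "frequently (\<lambda>n. x \<in> ?A n) sequentially"
        by (rule frequently_rev_mp) (use ev in eventually_elim, auto simp: space)
      then show ?case
        unfolding limsup_INF_SUP frequently_sequentially by auto
    qed
    then have "measure M (limsup ?A) = 1"
      using A_sets by (subst prob_eq_1) auto
    then have "borel_cantelli_seq M T (\<lambda>n. cball y (r n))"
      by (simp add: borel_cantelli_seq_def assms(2))
    \<comment> \<open>The lower bound on ball measures concerns radii tending to \<open>0\<close>,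
      which \<open>r n\<close> might not do. It is applied at \<open>real n powr - \<alpha>\<close>
      and carried over to \<open>r n\<close> by monotonicity of the measure.\<close>
    moreover have "filterlim (\<lambda>n. real n powr - \<alpha>) (at_right 0) sequentially"
      unfolding filterlim_at
      using exps(1)
      by (auto intro!: tendsto_neg_powr filterlim_real_sequentially eventually_sequentiallyI[of 1])
    then have "eventually (\<lambda>n. (real n powr - \<alpha>) powr D < measure M (cball y (real n powr - \<alpha>)))
        sequentially"
      by (rule eventually_compose_filterlim[OF lower])
    then have "eventually (\<lambda>n. real n powr - (\<alpha> * D * s) \<le> measure M (cball y (r n)) powr s)
        sequentially"
      using ev
    proof eventually_elim
      case (elim n)
      have "(real n powr - \<alpha>) powr D \<le> measure M (cball y (r n))"
        using elim(1)
        by (rule order.trans[OF less_imp_le finite_measure_mono])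
           (use elim(2) assms(2) in \<open>auto intro: subset_cball\<close>)
      then have "((real n powr - \<alpha>) powr D) powr s \<le> measure M (cball y (r n)) powr s"
        using assms(5) by (intro powr_mono2) auto
      then show ?case
        by (simp add: powr_powr)
    qed
    then have "(\<Sum>n. ennreal (measure M (cball y (r (Suc n))) powr s)) = \<infinity>"
    proof (rule suminf_ennreal_powr_eq_top)
      have "\<alpha> * D * s \<le> \<alpha> * D * s'"
        using exps by (intro mult_left_mono) auto
      also have "\<dots> \<le> 1"
        using exps by (simp add: mult_ac)
      finally show "\<alpha> * D * s \<le> 1" .
    qed
    ultimately show ?thesis
      by blast
  qed
  then show ?thesis
    by blast
qed

end
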